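(* Let $\lambda_1,\dots,\lambda_k$ and $\mu_1,\dots,\mu_{k_0}$ be positive, $\lambda=\sum_{j=1}^{k}\lambda_j$, and let $\hat M(t)=M(M'(t))$, where $\{M(t)\}_{t\ge0}$ and $\{M'(t)\}_{t\ge0}$ are independent generalized counting processes with rates $\lambda_1,\dots,\lambda_k$ and $\mu_1,\dots,\mu_{k_0}$, respectively. Let $X_1,X_2,\dots$ be i.i.d., independent of $\hat M$, with $\mathrm{Pr}\{X_1=i\}=\alpha_i$, $i=0,1,2,\dots$, and let $D(t)=\sum_{i=1}^{\hat M(t)}X_i$. Let $\{Z_i\}_{i\ge1}$ be i.i.d. random variables with $$\mathrm{Pr}\{Z_1=i\}=\frac1\lambda\sum_{j=1}^{k}\lambda_j\alpha_i^{*(j)},\quad i=0,1,2,\dots,\qquad \alpha_i^{*(j)}=\sum_{r_1+\dots+r_j=i,\ r_m\in\mathbb{N}_0}\alpha_{r_1}\cdots\alpha_{r_j}.$$ Let $\{M_0(t)\}_{t\ge0}$ be a generalized counting process with rates $\mu_1,\dots,\mu_{k_0}$, and let $\{Y_i\}_{i\ge1}$ be i.i.d. random variables, independent of $\{M_0(t)\}_{t\ge0}$, such that $Y_1\overset{d}{=}\sum_{i=1}^{N(1)}Z_i$, where $\{N(t)\}_{t\ge0}$ is a Poisson process with parameter $\lambda$ independent of the $Z_i$'s. Then, for every $t\ge0$, $$D(t)\overset{d}{=}\sum_{i=1}^{M_0(t)}Y_i .$$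
   Context: A generalized counting process (GCP) $\{M(t)\}_{t\ge0}$ with positive rates $\lambda_1,\dots,\lambda_k$ is a right-continuous $\mathbb{N}_0$-valued process with $M(0)=0$ and stationary independent increments, whose probability generating function is $\mathbb{E}(u^{M(t)})=\exp\big(-t\sum_{j=1}^{k}\lambda_j(1-u^j)\big)$, $|u|\le1$. The process $\hat M$ is the iterated generalized counting process (IGCP) and $D$ is a compound IGCP. The symbol $\overset{d}{=}$ denotes equality in distribution. *)

theory Defs
  imports "HOL-Probability.Probability"
begin

text \<open>All random variables here are integer-valued, so value types carry the discrete
  sigma-algebra throughout.\<close>

definition equal_in_distribution ::
  "'a measure \<Rightarrow> ('a \<Rightarrow> 'c) \<Rightarrow> 'b measure \<Rightarrow> ('b \<Rightarrow> 'c) \<Rightarrow> bool" where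
  "equal_in_distribution P X Q Y \<longleftrightarrow>
     X \<in> measurable P (count_space UNIV) \<and> Y \<in> measurable Q (count_space UNIV) \<and>
     distr P (count_space UNIV) X = distr Q (count_space UNIV) Y"

context prob_space
begin

definition generated_events :: "'i set \<Rightarrow> ('i \<Rightarrow> 'a \<Rightarrow> 'b) \<Rightarrow> 'a set set" where
  "generated_events I X = sigma_sets (space M) {X i -` A \<inter> space M | i A. i \<in> I}"

text \<open>Two families are independent as a whole, that is, the sigma-algebras they generate are
  independent. The library's \<open>indep_var\<close> is not used because it forces both
  random elements to have the same value type.\<close>

definition indep_families ::
  "'i set \<Rightarrow> ('i \<Rightarrow> 'a \<Rightarrow> 'b) \<Rightarrow> 'j set \<Rightarrow> ('j \<Rightarrow> 'a \<Rightarrow> 'c) \<Rightarrow> bool" where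
  "indep_families I X J Y \<longleftrightarrow> indep_set (generated_events I X) (generated_events J Y)"

definition iid :: "'i set \<Rightarrow> ('i \<Rightarrow> 'a \<Rightarrow> 'b) \<Rightarrow> bool" where
  "iid I X \<longleftrightarrow> indep_vars (\<lambda>_. count_space UNIV) X I \<and>
     (\<forall>i\<in>I. \<forall>j\<in>I. equal_in_distribution M (X i) M (X j))"

text \<open>Increments are taken in the integers, since subtraction of natural numbers truncates.\<close>

definition stationary_increments :: "(real \<Rightarrow> 'a \<Rightarrow> nat) \<Rightarrow> bool" where
  "stationary_increments X \<longleftrightarrow>
     (\<forall>s\<ge>0. \<forall>h\<ge>0. equal_in_distribution
        M (\<lambda>\<omega>. int (X (s + h) \<omega>) - int (X s \<omega>)) M (\<lambda>\<omega>. int (X h \<omega>) - int (X 0 \<omega>)))"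

definition independent_increments :: "(real \<Rightarrow> 'a \<Rightarrow> nat) \<Rightarrow> bool" where
  "independent_increments X \<longleftrightarrow>
     (\<forall>(n::nat) \<tau>. 0 \<le> \<tau> 0 \<and> (\<forall>i<n. \<tau> i < \<tau> (Suc i)) \<longrightarrow>
        indep_vars (\<lambda>_. count_space UNIV)
          (\<lambda>i \<omega>. int (X (\<tau> (Suc i)) \<omega>) - int (X (\<tau> i) \<omega>)) {..<n})"

text \<open>Only times \<open>t \<ge> 0\<close> matter; the values of \<open>X\<close> at negative times are arbitrary.\<close>

definition stationary_independent_process :: "(real \<Rightarrow> 'a \<Rightarrow> nat) \<Rightarrow> bool" where
  "stationary_independent_process X \<longleftrightarrow>
     (\<forall>t\<ge>0. random_variable (count_space UNIV) (X t)) \<and>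
     (AE \<omega> in M. X 0 \<omega> = 0) \<and>
     (AE \<omega> in M. \<forall>t\<ge>0. continuous (at_right t) (\<lambda>s. X s \<omega>)) \<and>
     stationary_increments X \<and> independent_increments X"

definition generalized_counting_process ::
  "nat \<Rightarrow> (nat \<Rightarrow> real) \<Rightarrow> (real \<Rightarrow> 'a \<Rightarrow> nat) \<Rightarrow> bool" where
  "generalized_counting_process k rate X \<longleftrightarrow>
     1 \<le> k \<and> (\<forall>j\<in>{1..k}. 0 < rate j) \<and>
     stationary_independent_process X \<and>
     (\<forall>t\<ge>0. \<forall>u::real. \<bar>u\<bar> \<le> 1 \<longrightarrow>
        expectation (\<lambda>\<omega>. u ^ X t \<omega>) = exp (- t * (\<Sum>j=1..k. rate j * (1 - u ^ j))))"

text \<open>The library's \<open>poisson_pmf\<close> requires a positive parameter; the law at time 0 is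
  fixed by \<open>N 0 = 0\<close>.\<close>

definition poisson_process :: "real \<Rightarrow> (real \<Rightarrow> 'a \<Rightarrow> nat) \<Rightarrow> bool" where
  "poisson_process rate N \<longleftrightarrow>
     0 < rate \<and> stationary_independent_process N \<and>
     (\<forall>t>0. distr M (count_space UNIV) (N t) = measure_pmf (poisson_pmf (rate * t)))"

end

definition iterated_process ::
  "(real \<Rightarrow> 'a \<Rightarrow> nat) \<Rightarrow> (real \<Rightarrow> 'a \<Rightarrow> nat) \<Rightarrow> real \<Rightarrow> 'a \<Rightarrow> nat" where
  "iterated_process N N' t \<omega> = N (real (N' t \<omega>)) \<omega>"

definition random_sum :: "('a \<Rightarrow> nat) \<Rightarrow> (nat \<Rightarrow> 'a \<Rightarrow> nat) \<Rightarrow> 'a \<Rightarrow> nat" where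
  "random_sum N X \<omega> = (\<Sum>i=1..N \<omega>. X i \<omega>)"

definition weak_compositions :: "nat \<Rightarrow> nat \<Rightarrow> (nat \<Rightarrow> nat) set" where
  "weak_compositions j i = {r \<in> {1..j} \<rightarrow>\<^sub>E UNIV. (\<Sum>m=1..j. r m) = i}"

lemma finite_weak_compositions: "finite (weak_compositions j i)"
proof (rule finite_subset)
  show "weak_compositions j i \<subseteq> {1..j} \<rightarrow>\<^sub>E {..i}"
  proof
    fix r assume r: "r \<in> weak_compositions j i"
    have "r m \<le> i" if "m \<in> {1..j}" for m
      using r member_le_sum[OF that, of r] by (auto simp: weak_compositions_def)
    then show "r \<in> {1..j} \<rightarrow>\<^sub>E {..i}"
      using r by (auto simp: weak_compositions_def PiE_def)
  qed
  show "finite ({1..j} \<rightarrow>\<^sub>E {..i})"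
    by (intro finite_PiE) auto
qed

definition convolution_power :: "(nat \<Rightarrow> real) \<Rightarrow> nat \<Rightarrow> nat \<Rightarrow> real" where
  "convolution_power \<alpha> j i = (\<Sum>r\<in>weak_compositions j i. \<Prod>m=1..j. \<alpha> (r m))"

end

theory Submission
  imports Defs
begin

text \<open>
  Everything is compared through probability generating functions on \<open>[-1, 1]\<close>. Conditioning on an
  independent counting variable turns a random sum into a composition of generating functions, and
  turns the iterated process into \<open>E v\<^bsup>M(M'(t))\<^esup> = E w\<^bsup>M'(t)\<^esup>\<close> with
  \<open>w = exp (- (\<Sum>j. \<lambda>\<^sub>j (1 - v\<^sup>j)))\<close>. Taking \<open>v\<close> to be the generating function of \<open>X\<^sub>1\<close>, the generating
  function of \<open>Z\<^sub>1\<close> is \<open>(\<Sum>j. \<lambda>\<^sub>j v\<^sup>j) / \<lambda>\<close>, because \<open>\<alpha>\<^bsup>*(j)\<^esup>\<close> is the law of a sum of \<open>j\<close> copies of \<open>X\<^sub>1\<close>;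
  hence \<open>w\<close> is the generating function of the compound Poisson variable \<open>Y\<^sub>1\<close>.
\<close>

section \<open>Power series and generating functions as real functions\<close>

text \<open>Strong induction: once all lower coefficients vanish, dividing by \<open>x ^ n\<close>
  leaves a series that is 0 off the origin and tends to \<open>c n\<close> at the origin. Applied to
  the difference of two generating functions, this recovers point probabilities.\<close>

lemma powser_sums_zero_imp_coeff_zero:
  fixes c :: "nat \<Rightarrow> real"
  assumes "\<And>x. \<bar>x\<bar> < 1 \<Longrightarrow> (\<lambda>n. c n * x ^ n) sums 0"
  shows "c n = 0"
proof (induction n rule: less_induct)
  case (less n)
  have "(\<lambda>i. c (i + n) * x ^ i) sums 0" if x: "x \<noteq> 0" "norm x < 1" for x :: real
  proof -
    have "(\<lambda>i. c (i + n) * x ^ (i + n)) sums (0 - (\<Sum>i<n. c i * x ^ i))"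
      using assms[of x] x(2) by (subst sums_iff_shift) auto
    then have "(\<lambda>i. (c (i + n) * x ^ i) * x ^ n) sums (0 * x ^ n)"
      using less by (simp add: power_add mult.assoc)
    then show ?thesis
      using x(1) using sums_mult2_iff[of "x ^ n" "\<lambda>i. c (i + n) * x ^ i" 0] by simp
  qed
  \<comment> \<open>The limit theorem asks for the sum only at nonzero \<open>x\<close> of norm
    below 1, exactly where the division by \<open>x ^ n\<close> was legitimate.\<close>
  then have "((\<lambda>_::real. 0::real) \<longlongrightarrow> c (0 + n)) (at 0)"
    by (intro powser_limit_0_strong[of 1]) auto
  then show ?case
    using LIM_const_eq[of 0 "c n" "0::real"] by simp
qed

lemma abs_power_le_1:
  fixes u :: real
  assumes "\<bar>u\<bar> \<le> 1"
  shows "\<bar>u ^ n\<bar> \<le> 1"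
  using assms by (simp add: power_abs power_le_one)

lemma equal_in_distribution_pgf_eq:
  fixes S :: "'a \<Rightarrow> nat" and T :: "'b \<Rightarrow> nat" and u :: real
  assumes "equal_in_distribution P S Q T"
  shows "integral\<^sup>L P (\<lambda>\<omega>. u ^ S \<omega>) = integral\<^sup>L Q (\<lambda>\<omega>. u ^ T \<omega>)"
  using assms integral_distr[of S P "count_space UNIV" "\<lambda>n. u ^ n"]
    integral_distr[of T Q "count_space UNIV" "\<lambda>n. u ^ n"]
  by (simp add: equal_in_distribution_def)

section \<open>Conditioning on a random index\<close>

context prob_space
begin

text \<open>The events \<open>W = n\<close> partition the space, so at each point a single term of
  the series is nonzero. Sum and expectation may be exchanged because the n-th term is bounded in
  mean by the probability of \<open>W = n\<close>, and these probabilities are summable. All later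
  conditioning rests on this.\<close>

lemma expectation_at_random_index_sums:
  fixes f :: "nat \<Rightarrow> 'a \<Rightarrow> real"
  assumes W [measurable]: "random_variable (count_space UNIV) W"
    and f [measurable]: "\<And>n. f n \<in> borel_measurable M"
    and bound: "\<And>n \<omega>. \<bar>f n \<omega>\<bar> \<le> 1"
  shows "(\<lambda>n. expectation (\<lambda>\<omega>. indicator {\<omega> \<in> space M. W \<omega> = n} \<omega> * f n \<omega>))
           sums expectation (\<lambda>\<omega>. f (W \<omega>) \<omega>)"
proof -
  let ?A = "\<lambda>n. {\<omega> \<in> space M. W \<omega> = n}"
  let ?g = "\<lambda>n \<omega>. indicator (?A n) \<omega> * f n \<omega>"
  have [measurable]: "?A n \<in> events" for n
    by measurable
  have abs_g: "\<bar>?g n \<omega>\<bar> \<le> indicator (?A n) \<omega>" for n \<omega>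
    using bound[of n \<omega>] by (auto simp: indicator_def)
  have int: "integrable M (?g n)" for n
    by (rule integrable_const_bound[where B=1])
       (use bound[of n] in \<open>auto simp: indicator_def\<close>)
  have pointwise: "(\<lambda>n. ?g n \<omega>) sums f (W \<omega>) \<omega>" if "\<omega> \<in> space M" for \<omega>
    using sums_finite[of "{W \<omega>}" "\<lambda>n. ?g n \<omega>"] that by auto
  have "(\<lambda>n. prob (?A n)) sums prob (\<Union>n. ?A n)"
    by (rule finite_measure_UNION) (auto simp: disjoint_family_on_def)
  then have summ: "summable (\<lambda>n. prob (?A n))"
    by (rule sums_summable)
  have "(\<lambda>n. expectation (?g n)) sums expectation (\<lambda>\<omega>. \<Sum>n. ?g n \<omega>)"
  proof (rule sums_integral[OF int])
    show "AE \<omega> in M. summable (\<lambda>n. norm (?g n \<omega>))"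
    proof (rule AE_I2)
      fix \<omega>
      show "summable (\<lambda>n. norm (?g n \<omega>))"
        by (rule summable_finite[of "{W \<omega>}"]) auto
    qed
    show "summable (\<lambda>n. expectation (\<lambda>\<omega>. norm (?g n \<omega>)))"
    proof (rule summable_comparison_test[OF _ summ], intro exI allI impI)
      fix n
      have "expectation (\<lambda>\<omega>. norm (?g n \<omega>)) \<le> expectation (indicator (?A n))"
        using abs_g by (intro integral_mono integrable_norm int integrable_real_indicator)
          (auto simp: emeasure_eq_measure)
      then show "norm (expectation (\<lambda>\<omega>. norm (?g n \<omega>))) \<le> prob (?A n)"
        by (simp add: integral_nonneg_AE)
    qed
  qed
  also have "expectation (\<lambda>\<omega>. \<Sum>n. ?g n \<omega>) = expectation (\<lambda>\<omega>. f (W \<omega>) \<omega>)"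
    by (intro Bochner_Integration.integral_cong refl) (simp add: pointwise[THEN sums_unique, symmetric])
  finally show ?thesis .
qed

lemma pgf_sums:
  fixes u :: real
  assumes W [measurable]: "random_variable (count_space UNIV) W" and u: "\<bar>u\<bar> \<le> 1"
  shows "(\<lambda>n. prob {\<omega> \<in> space M. W \<omega> = n} * u ^ n) sums expectation (\<lambda>\<omega>. u ^ W \<omega>)"
proof -
  have "{\<omega> \<in> space M. W \<omega> = n} \<in> events" for n
    by measurable
  then show ?thesis
    using expectation_at_random_index_sums[OF W, of "\<lambda>n _. u ^ n"] abs_power_le_1[OF u] by simp
qed

lemma abs_pgf_le_1:
  fixes u :: real
  assumes [measurable]: "random_variable (count_space UNIV) W" and u: "\<bar>u\<bar> \<le> 1"
  shows "\<bar>expectation (\<lambda>\<omega>. u ^ W \<omega>)\<bar> \<le> 1"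
proof -
  have "\<bar>expectation (\<lambda>\<omega>. u ^ W \<omega>)\<bar> \<le> expectation (\<lambda>\<omega>. \<bar>u ^ W \<omega>\<bar>)"
    using integral_norm_bound[of M "\<lambda>\<omega>. u ^ W \<omega>"] by simp
  also have "\<dots> \<le> 1"
    using abs_power_le_1[OF u] by (intro integral_le_const integrable_const_bound[where B=1]) auto
  finally show ?thesis .
qed

text \<open>On \<open>T = n\<close> the index is frozen, and independence splits off the factor
  \<open>prob (T = n)\<close>. Independence is asked only of level sets of \<open>T\<close> and
  \<open>S n\<close>, so \<open>T\<close> and the family \<open>S\<close> may come from families
  with different value types.\<close>

lemma pgf_random_index_sums:
  fixes u :: real
  assumes T [measurable]: "random_variable (count_space UNIV) T"
    and S [measurable]: "\<And>n. random_variable (count_space UNIV) (S n)"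
    and indep: "\<And>n i. prob ({\<omega> \<in> space M. T \<omega> = n} \<inter> {\<omega> \<in> space M. S n \<omega> = i})
                 = prob {\<omega> \<in> space M. T \<omega> = n} * prob {\<omega> \<in> space M. S n \<omega> = i}"
    and u: "\<bar>u\<bar> \<le> 1"
  shows "(\<lambda>n. prob {\<omega> \<in> space M. T \<omega> = n} * expectation (\<lambda>\<omega>. u ^ S n \<omega>))
           sums expectation (\<lambda>\<omega>. u ^ S (T \<omega>) \<omega>)"
proof -
  let ?A = "\<lambda>n. {\<omega> \<in> space M. T \<omega> = n}" and ?B = "\<lambda>n i. {\<omega> \<in> space M. S n \<omega> = i}"
  have A [measurable]: "?A n \<in> events" and B [measurable]: "?B n i \<in> events" for n i
    by measurable
  have "expectation (\<lambda>\<omega>. indicator (?A n) \<omega> * u ^ S n \<omega>)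
      = prob (?A n) * expectation (\<lambda>\<omega>. u ^ S n \<omega>)" for n
  proof -
    \<comment> \<open>A second decomposition, now over the values of \<open>S n\<close> with the
      indicator of \<open>T = n\<close> carried along, reduces the product rule for expectations to
      the one for events.\<close>
    have "(\<lambda>i. expectation (\<lambda>\<omega>. indicator (?B n i) \<omega> * (indicator (?A n) \<omega> * u ^ i)))
        sums expectation (\<lambda>\<omega>. indicator (?A n) \<omega> * u ^ S n \<omega>)"
      using expectation_at_random_index_sums[OF S[of n], of "\<lambda>i \<omega>. indicator (?A n) \<omega> * u ^ i"]
        abs_power_le_1[OF u] by (simp add: indicator_def)
    moreover have "expectation (\<lambda>\<omega>. indicator (?B n i) \<omega> * (indicator (?A n) \<omega> * u ^ i))
        = prob (?A n) * (prob (?B n i) * u ^ i)" for i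
    proof -
      have "expectation (\<lambda>\<omega>. indicator (?B n i) \<omega> * (indicator (?A n) \<omega> * u ^ i))
          = expectation (\<lambda>\<omega>. indicator (?A n \<inter> ?B n i) \<omega> * u ^ i)"
        by (intro Bochner_Integration.integral_cong refl) (auto simp: indicator_def)
      also have "\<dots> = prob (?A n \<inter> ?B n i) * u ^ i"
        using A B by (simp add: sets.Int)
      finally show ?thesis
        by (simp add: indep)
    qed
    ultimately show ?thesis
      using sums_mult[OF pgf_sums[OF S[of n] u], of "prob (?A n)"] sums_unique2 by simp blast
  qed
  then show ?thesis
    using expectation_at_random_index_sums[OF T, of "\<lambda>n \<omega>. u ^ S n \<omega>"] abs_power_le_1[OF u] by simp
qed

section \<open>Sums of i.i.d. variables and convolution powers\<close>

lemma iid_random_variable: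
  assumes "iid I X" "i \<in> I"
  shows "random_variable (count_space UNIV) (X i)"
  using assms by (auto simp: iid_def indep_vars_def)

lemma iid_equal_in_distribution:
  assumes "iid I X" "i \<in> I" "j \<in> I"
  shows "equal_in_distribution M (X i) M (X j)"
  using assms unfolding iid_def by blast

lemma iid_sum_pgf:
  fixes X :: "nat \<Rightarrow> 'a \<Rightarrow> nat" and u :: real
  assumes X: "iid {1..} X" and u: "\<bar>u\<bar> \<le> 1"
  shows "expectation (\<lambda>\<omega>. u ^ (\<Sum>i=1..n. X i \<omega>)) = expectation (\<lambda>\<omega>. u ^ X 1 \<omega>) ^ n"
proof -
  have rv [measurable]: "random_variable (count_space UNIV) (X i)" if "i \<in> {1..}" for i
    using iid_random_variable[OF X that] .
  have indep: "indep_vars (\<lambda>_. borel) (\<lambda>i \<omega>. u ^ X i \<omega>) {1..n}"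
  proof (rule indep_vars_compose2[where M'="\<lambda>_. count_space UNIV" and X=X and Y="\<lambda>_ n. u ^ n"])
    show "indep_vars (\<lambda>_. count_space UNIV) X {1..n}"
      using X unfolding iid_def by (rule indep_vars_subset[OF conjunct1]) simp
  qed simp
  have ident: "expectation (\<lambda>\<omega>. u ^ X i \<omega>) = expectation (\<lambda>\<omega>. u ^ X 1 \<omega>)" if "i \<in> {1..}" for i
    using that by (intro equal_in_distribution_pgf_eq iid_equal_in_distribution[OF X]) auto
  have "expectation (\<lambda>\<omega>. u ^ (\<Sum>i=1..n. X i \<omega>)) = expectation (\<lambda>\<omega>. \<Prod>i=1..n. u ^ X i \<omega>)"
    by (simp add: power_sum)
  also have "\<dots> = (\<Prod>i=1..n. expectation (\<lambda>\<omega>. u ^ X i \<omega>))"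
    using rv abs_power_le_1[OF u]
    by (intro indep_vars_lebesgue_integral indep integrable_const_bound[where B=1]) auto
  also have "\<dots> = (\<Prod>i=1..n. expectation (\<lambda>\<omega>. u ^ X 1 \<omega>))"
    by (intro prod.cong refl ident) simp
  also have "\<dots> = expectation (\<lambda>\<omega>. u ^ X 1 \<omega>) ^ n"
    by simp
  finally show ?thesis .
qed

text \<open>The event that the sum equals \<open>i\<close> splits according to the vector of values
  of the first \<open>j\<close> variables, which ranges over the weak compositions; independence
  makes each piece a product. With \<open>1 \<le> j\<close> the intersection defining a piece has a
  nonempty index set and stays inside the space.\<close>

lemma prob_iid_sum_eq_convolution_power:
  fixes X :: "nat \<Rightarrow> 'a \<Rightarrow> nat"
  assumes X: "iid {1..} X" and law: "\<And>i. prob {\<omega> \<in> space M. X 1 \<omega> = i} = \<alpha> i" and j: "1 \<le> j"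
  shows "prob {\<omega> \<in> space M. (\<Sum>m=1..j. X m \<omega>) = i} = convolution_power \<alpha> j i"
proof -
  have rv [measurable]: "random_variable (count_space UNIV) (X m)" if "m \<in> {1..}" for m
    using iid_random_variable[OF X that] .
  have ident: "prob (X m -` {i} \<inter> space M) = \<alpha> i" if "m \<in> {1..}" for m i
  proof -
    have "distr M (count_space UNIV) (X m) = distr M (count_space UNIV) (X 1)"
      using iid_equal_in_distribution[OF X that, of 1] by (simp add: equal_in_distribution_def)
    then have "measure (distr M (count_space UNIV) (X m)) {i}
        = measure (distr M (count_space UNIV) (X 1)) {i}"
      by simp
    moreover have "X 1 -` {i} \<inter> space M = {\<omega> \<in> space M. X 1 \<omega> = i}"
      by auto
    ultimately show ?thesis
      using that law[of i] by (simp add: measure_distr rv)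
  qed
  define E where "E r = (\<Inter>m\<in>{1..j}. X m -` {r m} \<inter> space M)" for r
  have "{\<omega> \<in> space M. (\<Sum>m=1..j. X m \<omega>) = i} = (\<Union>r\<in>weak_compositions j i. E r)"
  proof (intro equalityI subsetI)
    fix \<omega> assume \<omega>: "\<omega> \<in> {\<omega> \<in> space M. (\<Sum>m=1..j. X m \<omega>) = i}"
    \<comment> \<open>Weak compositions are extensional functions on \<open>{1..j}\<close>, so the
      vector of values has to be restricted to that set.\<close>
    then have "restrict (\<lambda>m. X m \<omega>) {1..j} \<in> weak_compositions j i"
      by (auto simp: weak_compositions_def)
    moreover have "\<omega> \<in> E (restrict (\<lambda>m. X m \<omega>) {1..j})"
      using \<omega> by (auto simp: E_def)
    ultimately show "\<omega> \<in> (\<Union>r\<in>weak_compositions j i. E r)"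
      by blast
  next
    fix \<omega> assume "\<omega> \<in> (\<Union>r\<in>weak_compositions j i. E r)"
    then show "\<omega> \<in> {\<omega> \<in> space M. (\<Sum>m=1..j. X m \<omega>) = i}"
      using j by (fastforce simp: E_def weak_compositions_def)
  qed
  also have "prob \<dots> = (\<Sum>r\<in>weak_compositions j i. prob (E r))"
  proof (rule finite_measure_finite_Union[OF finite_weak_compositions])
    have "E r \<in> events" for r
      unfolding E_def using j by (intro sets.finite_INT measurable_sets[OF rv]) auto
    then show "E ` weak_compositions j i \<subseteq> events"
      by blast
    show "disjoint_family_on E (weak_compositions j i)"
      unfolding disjoint_family_on_def
    proof (intro ballI impI)
      fix r s assume rs: "r \<in> weak_compositions j i" "s \<in> weak_compositions j i" "r \<noteq> s"
      then have "r \<in> {1..j} \<rightarrow>\<^sub>E UNIV" "s \<in> {1..j} \<rightarrow>\<^sub>E UNIV"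
        by (simp_all add: weak_compositions_def)
      \<comment> \<open>Extensionality forces distinct compositions to differ at an index inside
        \<open>{1..j}\<close>, where one variable would need two values.\<close>
      with rs(3) obtain m where "m \<in> {1..j}" "r m \<noteq> s m"
        by (meson PiE_ext)
      then show "E r \<inter> E s = {}"
        by (auto simp: E_def)
    qed
  qed
  also have "\<dots> = convolution_power \<alpha> j i"
    unfolding convolution_power_def
  proof (intro sum.cong refl)
    fix r
    have "prob (E r) = (\<Prod>m\<in>{1..j}. prob (X m -` {r m} \<inter> space M))"
      unfolding E_def using X j
      by (intro indep_varsD[where I="{1..}" and M'="\<lambda>_. count_space UNIV"]) (auto simp: iid_def)
    then show "prob (E r) = (\<Prod>m=1..j. \<alpha> (r m))"
      using ident by simp
  qed
  finally show ?thesis .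
qed

text \<open>Both sides are the generating function of a sum of \<open>j\<close> copies of
  \<open>X 1\<close>: the series reads it off the law, the power comes from independence.\<close>

lemma convolution_power_pgf_sums:
  fixes X :: "nat \<Rightarrow> 'a \<Rightarrow> nat" and u :: real
  assumes X: "iid {1..} X" and law: "\<And>i. prob {\<omega> \<in> space M. X 1 \<omega> = i} = \<alpha> i"
    and "1 \<le> j" and u: "\<bar>u\<bar> \<le> 1"
  shows "(\<lambda>i. convolution_power \<alpha> j i * u ^ i) sums (expectation (\<lambda>\<omega>. u ^ X 1 \<omega>) ^ j)"
proof -
  have "random_variable (count_space UNIV) (\<lambda>\<omega>. \<Sum>m=1..j. X m \<omega>)"
    using iid_random_variable[OF X] by (intro measurable_sum_nat) auto
  from pgf_sums[OF this u] show ?thesis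
    by (simp add: iid_sum_pgf[OF X u, simplified] prob_iid_sum_eq_convolution_power[OF assms(1-3), simplified])
qed

section \<open>Independence of families through generated sigma-algebras\<close>

lemma sets_sigma_family:
  "sets (sigma (space M) {X i -` A \<inter> space M | i A. i \<in> I}) = generated_events I X"
  unfolding generated_events_def by (rule sets_measure_of) auto

text \<open>Measurability with respect to the sigma-algebra of a family puts the level sets among
  the events that \<open>indep_families\<close> speaks of. This covers single members as well as
  finite sums of members.\<close>

lemma indep_families_prob_Int:
  assumes indep: "indep_families I X J Y"
    and S: "S \<in> measurable (sigma (space M) {X i -` A \<inter> space M | i A. i \<in> I}) (count_space UNIV)"
    and T: "T \<in> measurable (sigma (space M) {Y j -` A \<inter> space M | j A. j \<in> J}) (count_space UNIV)"
  shows "prob ({\<omega> \<in> space M. S \<omega> = a} \<inter> {\<omega> \<in> space M. T \<omega> = b})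
       = prob {\<omega> \<in> space M. S \<omega> = a} * prob {\<omega> \<in> space M. T \<omega> = b}"
proof (rule indep_setD)
  show "indep_set (generated_events I X) (generated_events J Y)"
    using indep by (simp add: indep_families_def)
  have "S -` {a} \<inter> space M \<in> generated_events I X"
    using measurable_sets[OF S, of "{a}"] unfolding sets_sigma_family by (simp add: space_measure_of_conv)
  then show "{\<omega> \<in> space M. S \<omega> = a} \<in> generated_events I X"
    by (simp add: vimage_def Int_def conj_commute)
  have "T -` {b} \<inter> space M \<in> generated_events J Y"
    using measurable_sets[OF T, of "{b}"] unfolding sets_sigma_family by (simp add: space_measure_of_conv)
  then show "{\<omega> \<in> space M. T \<omega> = b} \<in> generated_events J Y"
    by (simp add: vimage_def Int_def conj_commute)
qed

lemma measurable_family_member: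
  assumes "i \<in> I"
  shows "X i \<in> measurable (sigma (space M) {X i -` A \<inter> space M | i A. i \<in> I}) (count_space UNIV)"
proof (rule measurableI)
  fix A :: "'c set"
  have "X i -` A \<inter> space M \<in> generated_events I X"
    unfolding generated_events_def using assms by (intro sigma_sets.Basic) blast
  then show "X i -` A \<inter> space (sigma (space M) {X i -` A \<inter> space M | i A. i \<in> I})
      \<in> sets (sigma (space M) {X i -` A \<inter> space M | i A. i \<in> I})"
    unfolding sets_sigma_family by (simp add: space_measure_of_conv)
qed simp

lemma indep_families_sym:
  assumes "indep_families I X J Y"
  shows "indep_families J Y I X"
proof -
  have "indep_set (generated_events I X) (generated_events J Y)"
    using assms by (simp add: indep_families_def)
  then show ?thesis
    unfolding indep_families_def indep_sets2_eq by (metis Int_commute mult.commute)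
qed

section \<open>Generating functions of random sums, iterated processes and Poisson processes\<close>

lemma random_sum_random_variable:
  assumes "random_variable (count_space UNIV) T" and "iid {1..} X"
  shows "random_variable (count_space UNIV) (random_sum T X)"
proof -
  have "random_variable (count_space UNIV) (\<lambda>\<omega>. \<Sum>i=1..n. X i \<omega>)" for n
    using iid_random_variable[OF assms(2)] by (intro measurable_sum_nat) auto
  from measurable_compose_countable[OF this assms(1)] show ?thesis
    by (simp add: random_sum_def[abs_def])
qed

text \<open>Given \<open>T s = n\<close>, the sum has generating function \<open>?v ^ n\<close>;
  averaging over \<open>n\<close> gives the generating function of \<open>T s\<close> evaluated at
  \<open>?v\<close>.\<close>

lemma random_sum_pgf:
  fixes u :: real
  assumes T: "random_variable (count_space UNIV) (T s)" and X: "iid {1..} X"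
    and indep: "indep_families {1..} X J T" and s: "s \<in> J" and u: "\<bar>u\<bar> \<le> 1"
  shows "expectation (\<lambda>\<omega>. u ^ random_sum (T s) X \<omega>)
       = expectation (\<lambda>\<omega>. expectation (\<lambda>\<omega>'. u ^ X 1 \<omega>') ^ T s \<omega>)"
proof -
  let ?v = "expectation (\<lambda>\<omega>. u ^ X 1 \<omega>)"
  have S: "random_variable (count_space UNIV) (\<lambda>\<omega>. \<Sum>i=1..n. X i \<omega>)" for n
    using iid_random_variable[OF X] by (intro measurable_sum_nat) auto
  have v: "\<bar>?v\<bar> \<le> 1"
    by (rule abs_pgf_le_1[OF iid_random_variable[OF X] u]) simp
  have "(\<lambda>n. prob {\<omega> \<in> space M. T s \<omega> = n} * expectation (\<lambda>\<omega>. u ^ (\<Sum>i=1..n. X i \<omega>)))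
      sums expectation (\<lambda>\<omega>. u ^ (\<Sum>i=1..T s \<omega>. X i \<omega>))"
  proof (rule pgf_random_index_sums[OF T S _ u])
    fix n i
    show "prob ({\<omega> \<in> space M. T s \<omega> = n} \<inter> {\<omega> \<in> space M. (\<Sum>i=1..n. X i \<omega>) = i})
        = prob {\<omega> \<in> space M. T s \<omega> = n} * prob {\<omega> \<in> space M. (\<Sum>i=1..n. X i \<omega>) = i}"
      by (rule indep_families_prob_Int[OF indep_families_sym[OF indep] measurable_family_member[OF s]])
         (intro measurable_sum_nat measurable_family_member, auto)
  qed
  then have "(\<lambda>n. prob {\<omega> \<in> space M. T s \<omega> = n} * ?v ^ n) sums expectation (\<lambda>\<omega>. u ^ random_sum (T s) X \<omega>)"
    by (simp only: iid_sum_pgf[OF X u] random_sum_def)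
  with pgf_sums[OF T v] show ?thesis
    using sums_unique2 by blast
qed

text \<open>\<open>B t\<close> takes only natural values, so countably many time sections of
  \<open>A\<close> are combined and their individual measurability suffices.\<close>

lemma iterated_process_random_variable:
  assumes "\<And>s. 0 \<le> s \<Longrightarrow> random_variable (count_space UNIV) (A s)"
    and "random_variable (count_space UNIV) (B t)"
  shows "random_variable (count_space UNIV) (iterated_process A B t)"
  using measurable_compose_countable[OF assms(1) assms(2), of real]
  by (simp add: iterated_process_def[abs_def])

lemma generalized_counting_process_random_variable:
  assumes "generalized_counting_process k rate A" "0 \<le> t"
  shows "random_variable (count_space UNIV) (A t)"
  using assms by (simp add: generalized_counting_process_def stationary_independent_process_def)

text \<open>Given \<open>B t = n\<close>, the outer process is stopped at time \<open>n\<close>, and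
  its generating function is exponential in time, hence an n-th power. The average is again a
  generating function of \<open>B t\<close>.\<close>

lemma iterated_process_pgf:
  fixes v :: real
  assumes A: "generalized_counting_process k rate A" and B: "generalized_counting_process k' rate' B"
    and indep: "indep_families {0..} A {0..} B" and t: "0 \<le> t" and v: "\<bar>v\<bar> \<le> 1"
  shows "expectation (\<lambda>\<omega>. v ^ iterated_process A B t \<omega>)
       = expectation (\<lambda>\<omega>. exp (- (\<Sum>j=1..k. rate j * (1 - v ^ j))) ^ B t \<omega>)"
proof -
  let ?e = "\<Sum>j=1..k. rate j * (1 - v ^ j)"
  have rate: "0 < rate j" if "j \<in> {1..k}" for j
    using A that by (simp add: generalized_counting_process_def)
  \<comment> \<open>Nonnegativity of the exponent keeps \<open>exp (- ?e)\<close> in the interval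
    where the generating function of \<open>B t\<close> is available.\<close>
  have "0 \<le> ?e"
    using rate abs_power_le_1[OF v] by (intro sum_nonneg mult_nonneg_nonneg) (auto simp: abs_le_iff less_imp_le)
  then have w: "\<bar>exp (- ?e)\<bar> \<le> 1"
    by simp
  have "(\<lambda>n. prob {\<omega> \<in> space M. B t \<omega> = n} * expectation (\<lambda>\<omega>. v ^ A (real n) \<omega>))
      sums expectation (\<lambda>\<omega>. v ^ A (real (B t \<omega>)) \<omega>)"
    using generalized_counting_process_random_variable[OF B t] generalized_counting_process_random_variable[OF A] v t
    by (intro pgf_random_index_sums indep_families_prob_Int[OF indep_families_sym[OF indep]]
          measurable_family_member) auto
  moreover have "expectation (\<lambda>\<omega>. v ^ A (real n) \<omega>) = exp (- ?e) ^ n" for n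
    using A v by (simp add: generalized_counting_process_def flip: exp_of_nat_mult)
  ultimately have "(\<lambda>n. prob {\<omega> \<in> space M. B t \<omega> = n} * exp (- ?e) ^ n)
      sums expectation (\<lambda>\<omega>. v ^ iterated_process A B t \<omega>)"
    by (simp add: iterated_process_def)
  with pgf_sums[OF generalized_counting_process_random_variable[OF B t] w] show ?thesis
    using sums_unique2 by blast
qed

lemma poisson_process_pgf:
  fixes z :: real
  assumes N: "poisson_process rate N" and t: "0 < t" and z: "\<bar>z\<bar> \<le> 1"
  shows "expectation (\<lambda>\<omega>. z ^ N t \<omega>) = exp (- rate * t * (1 - z))"
proof -
  have rv [measurable]: "random_variable (count_space UNIV) (N t)" and rate: "0 < rate * t"
    using N t by (auto simp: poisson_process_def stationary_independent_process_def)
  have "prob {\<omega> \<in> space M. N t \<omega> = n} = (rate * t) ^ n / fact n * exp (- (rate * t))" for n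
  proof -
    have "prob {\<omega> \<in> space M. N t \<omega> = n} = measure (distr M (count_space UNIV) (N t)) {n}"
      by (subst measure_distr) (auto simp: vimage_def Int_def conj_commute)
    also have "\<dots> = pmf (poisson_pmf (rate * t)) n"
      using N t by (simp add: poisson_process_def pmf.rep_eq)
    finally show ?thesis
      using rate by simp
  qed
  \<comment> \<open>Absorbing \<open>z ^ n\<close> into the Poisson weights gives the exponential
    series at \<open>rate * t * z\<close>.\<close>
  then have "(\<lambda>n. exp (- (rate * t)) * ((rate * t * z) ^ n /\<^sub>R fact n))
      sums expectation (\<lambda>\<omega>. z ^ N t \<omega>)"
    using pgf_sums[OF rv z] by (simp add: power_mult_distrib divide_inverse mult_ac)
  moreover have "(\<lambda>n. exp (- (rate * t)) * ((rate * t * z) ^ n /\<^sub>R fact n))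
      sums (exp (- (rate * t)) * exp (rate * t * z))"
    by (intro sums_mult exp_converges)
  ultimately show ?thesis
    using sums_unique2 by (fastforce simp: algebra_simps simp flip: exp_add)
qed

end

section \<open>From equal generating functions to equal laws\<close>

text \<open>The difference of the two generating functions is a power series vanishing on the open
  interval, so all point masses agree, and these determine a law on a countable discrete
  space.\<close>

lemma equal_in_distribution_pgfI:
  fixes S :: "'a \<Rightarrow> nat" and T :: "'b \<Rightarrow> nat"
  assumes P: "prob_space P" and Q: "prob_space Q"
    and S: "S \<in> measurable P (count_space UNIV)" and T: "T \<in> measurable Q (count_space UNIV)"
    and pgf: "\<And>u::real. \<bar>u\<bar> \<le> 1 \<Longrightarrow>
      integral\<^sup>L P (\<lambda>\<omega>. u ^ S \<omega>) = integral\<^sup>L Q (\<lambda>\<omega>. u ^ T \<omega>)"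
  shows "equal_in_distribution P S Q T"
proof -
  interpret P: prob_space P by fact
  interpret Q: prob_space Q by fact
  let ?p = "\<lambda>n. measure P {\<omega> \<in> space P. S \<omega> = n}" and ?q = "\<lambda>n. measure Q {\<omega> \<in> space Q. T \<omega> = n}"
  have "(\<lambda>n. (?p n - ?q n) * u ^ n) sums 0" if "\<bar>u\<bar> < 1" for u
    using sums_diff[OF P.pgf_sums[OF S] Q.pgf_sums[OF T], of u u] pgf[of u] that
    by (simp add: left_diff_distrib)
  then have eq: "?p n = ?q n" for n
    using powser_sums_zero_imp_coeff_zero[of "\<lambda>n. ?p n - ?q n"] by simp
  have "distr P (count_space UNIV) S = distr Q (count_space UNIV) T"
  proof (rule measure_eqI_countable[of _ UNIV])
    fix n
    show "emeasure (distr P (count_space UNIV) S) {n} = emeasure (distr Q (count_space UNIV) T) {n}"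
      using S T eq[of n]
      by (simp add: emeasure_distr P.emeasure_eq_measure Q.emeasure_eq_measure
          vimage_def Int_def conj_commute)
  qed auto
  with S T show ?thesis
    by (simp add: equal_in_distribution_def)
qed

section \<open>The compound iterated process as a compound of \<open>M0\<close>\<close>

theorem mainTheorem11:
  fixes P :: "'a measure" and Q :: "'b measure" and R :: "'c measure"
    and k k0 :: nat and lam mu :: "nat \<Rightarrow> real" and lambda :: real and \<alpha> :: "nat \<Rightarrow> real"
    and M M' :: "real \<Rightarrow> 'a \<Rightarrow> nat" and X :: "nat \<Rightarrow> 'a \<Rightarrow> nat"
    and M0 :: "real \<Rightarrow> 'b \<Rightarrow> nat" and Y :: "nat \<Rightarrow> 'b \<Rightarrow> nat"
    and N :: "real \<Rightarrow> 'c \<Rightarrow> nat" and Z :: "nat \<Rightarrow> 'c \<Rightarrow> nat"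
    and t :: real
  assumes "prob_space P" and "prob_space Q" and "prob_space R"
    and "1 \<le> k" and "\<And>j. j \<in> {1..k} \<Longrightarrow> 0 < lam j"
    and "1 \<le> k0" and "\<And>j. j \<in> {1..k0} \<Longrightarrow> 0 < mu j"
    and "lambda = (\<Sum>j=1..k. lam j)"
    and "prob_space.generalized_counting_process P k lam M"
    and "prob_space.generalized_counting_process P k0 mu M'"
    and "prob_space.indep_families P {0..} M {0..} M'"
    and "prob_space.iid P {1..} X"
    and "prob_space.indep_families P {1..} X {0..} (iterated_process M M')"
    and "\<And>i. measure P {\<omega> \<in> space P. X 1 \<omega> = i} = \<alpha> i"
    and "prob_space.iid R {1..} Z"
    and "\<And>i. measure R {\<omega> \<in> space R. Z 1 \<omega> = i}
               = 1 / lambda * (\<Sum>j=1..k. lam j * convolution_power \<alpha> j i)"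
    and "prob_space.poisson_process R lambda N"
    and "prob_space.indep_families R {0..} N {1..} Z"
    and "prob_space.generalized_counting_process Q k0 mu M0"
    and "prob_space.iid Q {1..} Y"
    and "prob_space.indep_families Q {1..} Y {0..} M0"
    and "equal_in_distribution Q (Y 1) R (random_sum (N 1) Z)"
    and "0 \<le> t"
  shows "equal_in_distribution P (random_sum (iterated_process M M' t) X) Q (random_sum (M0 t) Y)"
proof (rule equal_in_distribution_pgfI[OF assms(1,2)])
  interpret P: prob_space P by fact
  interpret Q: prob_space Q by fact
  interpret R: prob_space R by fact
  note M = assms(9) and M' = assms(10) and X = assms(12) and Z = assms(15) and N = assms(17)
    and M0 = assms(19) and Y = assms(20) and t = assms(23)
  have iter: "iterated_process M M' t \<in> measurable P (count_space UNIV)"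
    using P.generalized_counting_process_random_variable[OF M]
      P.generalized_counting_process_random_variable[OF M' t]
    by (intro P.iterated_process_random_variable)
  have M0_rv: "M0 t \<in> measurable Q (count_space UNIV)"
    by (rule Q.generalized_counting_process_random_variable[OF M0 t])
  have N_rv: "N 1 \<in> measurable R (count_space UNIV)"
    using N by (simp add: R.poisson_process_def R.stationary_independent_process_def)
  show "random_sum (iterated_process M M' t) X \<in> measurable P (count_space UNIV)"
    by (rule P.random_sum_random_variable[OF iter X])
  show "random_sum (M0 t) Y \<in> measurable Q (count_space UNIV)"
    by (rule Q.random_sum_random_variable[OF M0_rv Y])
  have lambda: "0 < lambda"
    using N by (simp add: R.poisson_process_def)
  fix u :: real assume u: "\<bar>u\<bar> \<le> 1"
  \<comment> \<open>\<open>v\<close> and \<open>z\<close> are the generating functions of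
    \<open>X 1\<close> and \<open>Z 1\<close> at \<open>u\<close>; \<open>w\<close> is that of the
    outer process \<open>M\<close> at time 1, evaluated at \<open>v\<close>. The goal up to
    \<open>w_Y\<close> is that \<open>w\<close> is also the generating function of
    \<open>Y 1\<close> at \<open>u\<close>.\<close>
  define v where "v = P.expectation (\<lambda>\<omega>. u ^ X 1 \<omega>)"
  define w where "w = exp (- (\<Sum>j=1..k. lam j * (1 - v ^ j)))"
  define z where "z = R.expectation (\<lambda>\<omega>. u ^ Z 1 \<omega>)"
  have v: "\<bar>v\<bar> \<le> 1"
    unfolding v_def by (rule P.abs_pgf_le_1[OF P.iid_random_variable[OF X] u]) simp
  have Z1: "Z 1 \<in> measurable R (count_space UNIV)"
    by (rule R.iid_random_variable[OF Z]) simp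
  have z_le: "\<bar>z\<bar> \<le> 1"
    unfolding z_def by (rule R.abs_pgf_le_1[OF Z1 u])
  \<comment> \<open>The law of \<open>Z 1\<close> is a mixture of convolution powers, so one
    coefficient series sums both to the mixture of the powers \<open>v ^ j\<close> and to
    \<open>z\<close>.\<close>
  have "(\<lambda>i. 1 / lambda * (\<Sum>j=1..k. lam j * (convolution_power \<alpha> j i * u ^ i)))
      sums (1 / lambda * (\<Sum>j=1..k. lam j * v ^ j))"
    unfolding v_def
    by (intro sums_mult sums_sum P.convolution_power_pgf_sums[OF X assms(14) _ u]) auto
  moreover have "(\<lambda>i. 1 / lambda * (\<Sum>j=1..k. lam j * (convolution_power \<alpha> j i * u ^ i))) sums z"
    using R.pgf_sums[OF Z1 u] unfolding z_def assms(16)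
    by (simp add: sum_distrib_right mult.assoc)
  ultimately have "z = 1 / lambda * (\<Sum>j=1..k. lam j * v ^ j)"
    using sums_unique2 by blast
  \<comment> \<open>Because \<open>lambda\<close> is the total rate, the compound Poisson exponent
    at \<open>z\<close> equals the exponent of \<open>M\<close> at \<open>v\<close>; at time 1 no
    further factor appears.\<close>
  then have "lambda * (1 - z) = (\<Sum>j=1..k. lam j * (1 - v ^ j))"
    using lambda assms(8) by (simp add: right_diff_distrib sum_subtractf)
  then have w: "w = R.expectation (\<lambda>\<omega>. z ^ N 1 \<omega>)"
    using R.poisson_process_pgf[OF N _ z_le, of 1] by (simp add: w_def)
  also have "\<dots> = R.expectation (\<lambda>\<omega>. u ^ random_sum (N 1) Z \<omega>)"
    unfolding z_def
    by (rule R.random_sum_pgf[OF N_rv Z R.indep_families_sym[OF assms(18)] _ u, symmetric]) simp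
  also have "\<dots> = Q.expectation (\<lambda>\<omega>. u ^ Y 1 \<omega>)"
    by (rule equal_in_distribution_pgf_eq[OF assms(22), symmetric])
  finally have w_Y: "w = Q.expectation (\<lambda>\<omega>. u ^ Y 1 \<omega>)" .
  have w_le: "\<bar>w\<bar> \<le> 1"
    unfolding w_Y by (rule Q.abs_pgf_le_1[OF Q.iid_random_variable[OF Y] u]) simp
  have "P.expectation (\<lambda>\<omega>. u ^ random_sum (iterated_process M M' t) X \<omega>)
      = P.expectation (\<lambda>\<omega>. v ^ iterated_process M M' t \<omega>)"
    unfolding v_def using t by (intro P.random_sum_pgf[OF iter X assms(13) _ u]) simp
  also have "\<dots> = P.expectation (\<lambda>\<omega>. w ^ M' t \<omega>)"
    unfolding w_def by (rule P.iterated_process_pgf[OF M M' assms(11) t v])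
  \<comment> \<open>\<open>M'\<close> and \<open>M0\<close> live on different spaces but share the
    rates \<open>mu\<close>, so the defining formula gives both the same value at
    \<open>w\<close>.\<close>
  also have "\<dots> = Q.expectation (\<lambda>\<omega>. w ^ M0 t \<omega>)"
    using M' M0 t w_le by (simp add: P.generalized_counting_process_def Q.generalized_counting_process_def)
  also have "\<dots> = Q.expectation (\<lambda>\<omega>. u ^ random_sum (M0 t) Y \<omega>)"
    unfolding w_Y using t by (intro Q.random_sum_pgf[OF M0_rv Y assms(21) _ u, symmetric]) simp
  finally show "P.expectation (\<lambda>\<omega>. u ^ random_sum (iterated_process M M' t) X \<omega>)
      = Q.expectation (\<lambda>\<omega>. u ^ random_sum (M0 t) Y \<omega>)" .
qed

end
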